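(* Let $\Gamma$ be a locally finite connected graph and let $\{\xi_i\}_{i=1}^\infty$ be a sequence of i.i.d. random $\Gamma$-elements. If the weight function $M_{\xi_1}$ is totally defined and $\mu_{\xi_1}$ has finite support, then for some constant $C>0$ $$\mathbf{P}\bigl(\mathbb{S}(\xi_1,\dots,\xi_n)\not\subseteq\mathbb{E}(\xi_1)\bigr)\le O(e^{-Cn}),$$ that is, there are constants $C>0$ and $K>0$ (independent of $n$) such that the left-hand side is at most $Ke^{-Cn}$ for all $n\ge1$.
   Context: Let $(\Omega,\mathcal{F},\mathbf{P})$ be a probability space and let $d$ be the graph distance on $V(\Gamma)$. A random $\Gamma$-element is a measurable function $\xi:\Omega\to V(\Gamma)$ (with $V(\Gamma)$ discrete); its distribution is $\mu_\xi(v)=\mathbf{P}(\xi=v)$. The weight function is $M_\xi(v)=\sum_{s\in V(\Gamma)}d^2(v,s)\mu_\xi(s)$; it is totally defined if $M_\xi(v)<\infty$ for all $v\in V(\Gamma)$. In that case the mean-set of $\xi$ is $\mathbb{E}(\xi)=\{v\in V(\Gamma)\mid M_\xi(v)\le M_\xi(u)\ \forall u\in V(\Gamma)\}$. For a sample $\xi_1,\dots,\xi_n$ put $\mu_n(u)=\frac1n|\{i\mid 1\le i\le n,\ \xi_i=u\}|$ and $M_n(v)=\sum_{s\in V(\Gamma)}d^2(v,s)\mu_n(s)$. The sample mean-set is $\mathbb{S}(\xi_1,\dots,\xi_n)=\{v\in V(\Gamma)\mid M_n(v)\le M_n(u)\ \forall u\in V(\Gamma)\}$. *)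

theory Defs
  imports "HOL-Probability.Probability" "Graph_Theory.Graph_Theory"
begin

text \<open>
  Undirected graphs are symmetric digraphs (\<^locale>\<open>sym_digraph\<close>), with loops and parallel
  arcs permitted. By symmetry, counting outgoing arcs is enough for local finiteness.
\<close>

definition locally_finite_graph :: "('a, 'b) pre_digraph \<Rightarrow> bool" where
  "locally_finite_graph G \<longleftrightarrow> (\<forall>v\<in>verts G. finite (out_arcs G v))"

text \<open>
  The graph distance is the infimum of the costs of all walks, where every arc costs 1. In a
  connected symmetric graph it is the least length of a walk, see the lemma
  \<open>graph_dist_eq_Least\<close> below.
\<close>

definition graph_dist :: "('a, 'b) pre_digraph \<Rightarrow> 'a \<Rightarrow> 'a \<Rightarrow> real" where
  "graph_dist G u v = real_of_ereal (wf_digraph.\<mu> G (\<lambda>_. 1) u v)"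

definition prob_mass :: "'w measure \<Rightarrow> ('w \<Rightarrow> 'a) \<Rightarrow> 'a \<Rightarrow> real" where
  "prob_mass P X v = measure P {\<omega> \<in> space P. X \<omega> = v}"

text \<open>
  The weight is \<^typ>\<open>ennreal\<close>-valued, so that a divergent sum really has the value \<open>\<infinity>\<close>.
\<close>

definition weight :: "('a, 'b) pre_digraph \<Rightarrow> ('a \<Rightarrow> real) \<Rightarrow> 'a \<Rightarrow> ennreal" where
  "weight G m v = (\<Sum>\<^sub>\<infinity>s\<in>verts G. ennreal ((graph_dist G v s)\<^sup>2 * m s))"

definition weight_totally_defined :: "('a, 'b) pre_digraph \<Rightarrow> ('a \<Rightarrow> real) \<Rightarrow> bool" where
  "weight_totally_defined G m \<longleftrightarrow> (\<forall>v\<in>verts G. weight G m v < \<infinity>)"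

definition weight_minimizers :: "('a, 'b) pre_digraph \<Rightarrow> ('a \<Rightarrow> real) \<Rightarrow> 'a set" where
  "weight_minimizers G m = {v \<in> verts G. \<forall>u\<in>verts G. weight G m v \<le> weight G m u}"

definition mean_set :: "('a, 'b) pre_digraph \<Rightarrow> 'w measure \<Rightarrow> ('w \<Rightarrow> 'a) \<Rightarrow> 'a set" where
  "mean_set G P X = weight_minimizers G (prob_mass P X)"

definition empirical_mass :: "nat \<Rightarrow> (nat \<Rightarrow> 'a) \<Rightarrow> 'a \<Rightarrow> real" where
  "empirical_mass n x u = real (card {i \<in> {1..n}. x i = u}) / real n"

definition sample_mean_set :: "('a, 'b) pre_digraph \<Rightarrow> nat \<Rightarrow> (nat \<Rightarrow> 'a) \<Rightarrow> 'a set" where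
  "sample_mean_set G n x = weight_minimizers G (empirical_mass n x)"

lemma graph_dist_eq_Least:
  assumes "sym_digraph G" "Digraph_Component.connected G" "u \<in> verts G" "v \<in> verts G"
  shows "graph_dist G u v = real (LEAST k. \<exists>p. pre_digraph.awalk G u p v \<and> length p = k)"
proof -
  interpret sym_digraph G by fact
  have "u \<rightarrow>\<^sup>*\<^bsub>mk_symmetric G\<^esub> v"
    using assms(2-4) by (auto simp: Digraph_Component.connected_def strongly_connected_def)
  then have "u \<rightarrow>\<^sup>*\<^bsub>G\<^esub> v" using reachable_mk_symmetric_eq[OF sym_arcs] by simp
  then obtain p0 where p0: "awalk u p0 v" by (auto simp: reachable_awalk)
  define L where "L = (LEAST k. \<exists>p. awalk u p v \<and> length p = k)"
  have "\<exists>p. awalk u p v \<and> length p = L"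
    unfolding L_def by (rule LeastI_ex) (use p0 in blast)
  then obtain p where p: "awalk u p v" "length p = L" by blast
  have min: "L \<le> length q" if "awalk u q v" for q
    unfolding L_def by (rule Least_le) (use that in blast)
  have cost: "awalk_cost (\<lambda>_. 1) q = real (length q)" for q
    by (induction q) auto
  have "\<mu> (\<lambda>_. 1) u v = ereal (real L)"
    unfolding \<mu>_def
  proof (rule antisym)
    show "(INF q\<in>{q. awalk u q v}. ereal (awalk_cost (\<lambda>_. 1) q)) \<le> ereal (real L)"
      by (rule INF_lower2[of p]) (use p cost in auto)
    show "ereal (real L) \<le> (INF q\<in>{q. awalk u q v}. ereal (awalk_cost (\<lambda>_. 1) q))"
      by (rule INF_greatest) (use min cost in auto)
  qed
  then show ?thesis by (simp add: graph_dist_def L_def)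
qed

lemma countable_verts:
  assumes "sym_digraph G" "Digraph_Component.connected G" "locally_finite_graph G"
  shows "countable (verts G)"
proof -
  interpret sym_digraph G by fact
  from assms(2) obtain u where u: "u \<in> verts G"
    by (auto simp: Digraph_Component.connected_def strongly_connected_def)
  define B where "B n = ((\<lambda>S. (\<Union>v\<in>S. head G ` out_arcs G v)) ^^ n) {u}" for n
  have B: "finite (B n) \<and> B n \<subseteq> verts G" for n
  proof (induction n)
    case 0 then show ?case using u by (simp add: B_def)
  next
    case (Suc n)
    then show ?case using assms(3)
      by (auto simp: B_def locally_finite_graph_def out_arcs_def)
  qed
  have "v \<in> (\<Union>n. B n)" if "v \<in> verts G" for v
  proof -
    have "u \<rightarrow>\<^sup>*\<^bsub>mk_symmetric G\<^esub> v"
      using assms(2) u that by (auto simp: Digraph_Component.connected_def strongly_connected_def)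
    then have "u \<rightarrow>\<^sup>*\<^bsub>G\<^esub> v" using reachable_mk_symmetric_eq[OF sym_arcs] by simp
    then show ?thesis unfolding reachable_def
    proof (induction rule: rtrancl_on_induct)
      case base
      have "u \<in> B 0" by (simp add: B_def)
      then show ?case by blast
    next
      case (step y z)
      then obtain n where n: "y \<in> B n" by blast
      from step obtain e where "e \<in> out_arcs G y" "z = head G e"
        by (auto simp: arcs_ends_conv out_arcs_def)
      moreover have "B (Suc n) = (\<Union>v\<in>B n. head G ` out_arcs G v)" by (simp add: B_def)
      ultimately have "z \<in> B (Suc n)" using n by blast
      then show ?case by blast
    qed
  qed
  then have "verts G \<subseteq> (\<Union>n. B n)" by blast
  moreover have "countable (\<Union>n. B n)" using B by (blast intro: countable_UN countable_finite)
  ultimately show ?thesis by (rule countable_subset)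
qed

text \<open>
  The event whose probability is estimated is measurable, so its \<^const>\<open>measure\<close> is not the
  default value 0.
\<close>

lemma sets_sample_mean_set_event:
  assumes "sym_digraph G" "Digraph_Component.connected G" "locally_finite_graph G"
    and meas: "\<And>i. i \<ge> 1 \<Longrightarrow> \<xi> i \<in> measurable P (count_space (verts G))"
  shows "{\<omega> \<in> space P. \<not> sample_mean_set G n (\<lambda>i. \<xi> i \<omega>) \<subseteq> S} \<in> sets P"
proof -
  let ?X = "{x \<in> PiE {1..n} (\<lambda>_. verts G). \<not> sample_mean_set G n x \<subseteq> S}"
  let ?F = "\<lambda>x. {\<omega> \<in> space P. \<forall>i\<in>{1..n}. \<xi> i \<omega> = x i}"
  have cong: "sample_mean_set G n x = sample_mean_set G n y" if "\<forall>i\<in>{1..n}. x i = y i" for x y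
  proof -
    have "{i \<in> {1..n}. x i = u} = {i \<in> {1..n}. y i = u}" for u using that by auto
    then have "empirical_mass n x = empirical_mass n y" unfolding empirical_mass_def by simp
    then show ?thesis by (simp add: sample_mean_set_def)
  qed
  have eq: "{\<omega> \<in> space P. \<not> sample_mean_set G n (\<lambda>i. \<xi> i \<omega>) \<subseteq> S} = (\<Union>x\<in>?X. ?F x)"
  proof (intro equalityI subsetI)
    fix \<omega> assume \<omega>: "\<omega> \<in> {\<omega> \<in> space P. \<not> sample_mean_set G n (\<lambda>i. \<xi> i \<omega>) \<subseteq> S}"
    define x where "x = restrict (\<lambda>i. \<xi> i \<omega>) {1..n}"
    have "\<xi> i \<omega> \<in> verts G" if "i \<in> {1..n}" for i
      using measurable_space[OF meas, of i \<omega>] \<omega> that by auto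
    then have "x \<in> PiE {1..n} (\<lambda>_. verts G)" by (auto simp: x_def)
    moreover have "sample_mean_set G n x = sample_mean_set G n (\<lambda>i. \<xi> i \<omega>)"
      by (rule cong) (simp add: x_def)
    ultimately have "x \<in> ?X" "\<omega> \<in> ?F x" using \<omega> by (auto simp: x_def)
    then show "\<omega> \<in> (\<Union>x\<in>?X. ?F x)" by blast
  next
    fix \<omega> assume "\<omega> \<in> (\<Union>x\<in>?X. ?F x)"
    then obtain x where x: "x \<in> ?X" "\<omega> \<in> ?F x" by blast
    have "sample_mean_set G n (\<lambda>i. \<xi> i \<omega>) = sample_mean_set G n x"
      by (rule cong) (use x in simp)
    then show "\<omega> \<in> {\<omega> \<in> space P. \<not> sample_mean_set G n (\<lambda>i. \<xi> i \<omega>) \<subseteq> S}" using x by simp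
  qed
  have "countable ?X"
    by (rule countable_subset[of _ "PiE {1..n} (\<lambda>_. verts G)"])
       (auto intro!: countable_PiE countable_verts assms)
  moreover have "?F x \<in> sets P" if x: "x \<in> ?X" for x
  proof (rule sets.sets_Collect_finite_All)
    fix i assume i: "i \<in> {1..n}"
    have "\<xi> i -` {x i} \<inter> space P \<in> sets P"
      by (rule measurable_sets[OF meas]) (use x i in auto)
    moreover have "\<xi> i -` {x i} \<inter> space P = {\<omega> \<in> space P. \<xi> i \<omega> = x i}" by auto
    ultimately show "{\<omega> \<in> space P. \<xi> i \<omega> = x i} \<in> sets P" by simp
  qed simp
  ultimately show ?thesis unfolding eq by (intro sets.countable_UN' image_subsetI)
qed

end

theory Submission
  imports Defs
begin

text \<open>
  Let \<open>F\<close> be the finite support of the common distribution and fix a vertex \<open>c\<close>. A vertex \<open>v\<close> with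
  \<open>d(c,s) < d(v,s)\<close> for every \<open>s \<in> F\<close> has strictly larger weight than \<open>c\<close> with respect to \<^emph>\<open>every\<close>
  nonzero mass that lives on \<open>F\<close>. Almost surely all samples lie in \<open>F\<close>, so this applies both to the
  distribution and to the empirical masses: the mean-set and the sample mean-sets are contained in
  the same set \<open>B = {v. \<exists>s\<in>F. d(v,s) \<le> d(c,s)}\<close> (\<open>weight_le_imp_near_support\<close>). It is a finite
  union of balls, hence finite by local finiteness (\<open>finite_dist_ball\<close>), and so the mean-set is not
  empty.

  Choose \<open>w\<close> in the mean-set. If the sample mean-set is not contained in the mean-set, then some
  \<open>v \<in> B\<close> outside the mean-set has empirical weight at most that of \<open>w\<close>. That says that the
  i.i.d. bounded variables \<open>d(w,\<xi>\<^sub>i)\<^sup>2 - d(v,\<xi>\<^sub>i)\<^sup>2\<close> have a nonnegative sum, although their expectation,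
  the difference of the weights of \<open>w\<close> and \<open>v\<close>, is negative. Hoeffding's inequality bounds the
  probability of this by \<open>exp (- C\<^sub>v n)\<close> (\<open>iid_sum_nonneg_exponentially_small\<close>). Summing over the
  finitely many \<open>v\<close> gives the claim.
\<close>

section \<open>Balls in locally finite graphs\<close>

text \<open>
  The induction peels off the first arc of the walk. The start of that arc is an in-neighbour of the
  second vertex, and by symmetry in-neighbours are out-neighbours, of which there are finitely many.
\<close>

lemma finite_walk_sources:
  assumes "sym_digraph G" "locally_finite_graph G"
  shows "finite {v. \<exists>p. pre_digraph.awalk G v p s \<and> length p = k}"
proof (induction k)
  interpret sym_digraph G by fact
  case 0
  show ?case
    by (rule finite_subset[of _ "{s}"]) (auto simp: awalk_Nil_iff)
next
  interpret sym_digraph G by fact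
  case (Suc k)
  let ?S = "{v. \<exists>p. awalk v p s \<and> length p = k}"
  have "{v. \<exists>p. awalk v p s \<and> length p = Suc k} \<subseteq> (\<Union>w\<in>?S. head G ` out_arcs G w)"
  proof
    fix v assume "v \<in> {v. \<exists>p. awalk v p s \<and> length p = Suc k}"
    then obtain e p where e: "e \<in> arcs G" "v = tail G e" and p: "awalk (head G e) p s" "length p = k"
      by (auto simp: length_Suc_conv awalk_Cons_iff)
    have "(v, head G e) \<in> arcs_ends G" using e by (auto simp: arcs_ends_conv)
    then have "(head G e, v) \<in> arcs_ends G" using sym_arcs by (auto simp: symmetric_def dest: symD)
    then have "v \<in> head G ` out_arcs G (head G e)" by (auto simp: arcs_ends_conv)
    then show "v \<in> (\<Union>w\<in>?S. head G ` out_arcs G w)" using p by blast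
  qed
  moreover have "finite (\<Union>w\<in>?S. head G ` out_arcs G w)"
  proof (intro finite_UN_I finite_imageI)
    show "finite ?S" by (rule Suc)
    fix w assume "w \<in> ?S"
    then have "w \<in> verts G" by (auto dest: awalk_hd_in_verts)
    then show "finite (out_arcs G w)" using assms(2) by (auto simp: locally_finite_graph_def)
  qed
  ultimately show ?case by (rule finite_subset)
qed

lemma graph_dist_walk:
  assumes "sym_digraph G" "Digraph_Component.connected G" "u \<in> verts G" "v \<in> verts G"
  obtains p where "pre_digraph.awalk G u p v" "graph_dist G u v = real (length p)"
proof -
  interpret sym_digraph G by fact
  have "u \<rightarrow>\<^sup>*\<^bsub>mk_symmetric G\<^esub> v"
    using assms(2-4) by (auto simp: Digraph_Component.connected_def strongly_connected_def)
  then have "u \<rightarrow>\<^sup>*\<^bsub>G\<^esub> v" using reachable_mk_symmetric_eq[OF sym_arcs] by simp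
  then have "\<exists>k p. awalk u p v \<and> length p = k" by (auto simp: reachable_awalk)
  from LeastI_ex[OF this] show thesis
    using graph_dist_eq_Least[OF assms] that by auto
qed

lemma finite_dist_ball:
  assumes "sym_digraph G" "Digraph_Component.connected G" "locally_finite_graph G" "s \<in> verts G"
  shows "finite {v \<in> verts G. graph_dist G v s \<le> r}"
proof (rule finite_subset)
  show "{v \<in> verts G. graph_dist G v s \<le> r}
        \<subseteq> (\<Union>k\<le>nat \<lfloor>r\<rfloor>. {v. \<exists>p. pre_digraph.awalk G v p s \<and> length p = k})"
  proof
    fix v assume "v \<in> {v \<in> verts G. graph_dist G v s \<le> r}"
    then have v: "v \<in> verts G" "graph_dist G v s \<le> r" by auto
    obtain p where p: "pre_digraph.awalk G v p s" "graph_dist G v s = real (length p)"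
      using graph_dist_walk[OF assms(1,2) v(1) assms(4)] .
    have "length p \<le> nat \<lfloor>r\<rfloor>" using p(2) v(2) by (simp add: le_nat_floor)
    then show "v \<in> (\<Union>k\<le>nat \<lfloor>r\<rfloor>. {v. \<exists>p. pre_digraph.awalk G v p s \<and> length p = k})"
      using p(1) by auto
  qed
  show "finite (\<Union>k\<le>nat \<lfloor>r\<rfloor>. {v. \<exists>p. pre_digraph.awalk G v p s \<and> length p = k})"
    by (intro finite_UN_I finite_walk_sources assms) simp
qed

lemma graph_dist_nonneg:
  assumes "sym_digraph G" "Digraph_Component.connected G" "u \<in> verts G" "v \<in> verts G"
  shows "0 \<le> graph_dist G u v"
  using graph_dist_eq_Least[OF assms] by simp

section \<open>Weights of finitely supported masses\<close>

text \<open>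
  The step from \<^typ>\<open>ennreal\<close> to real sums makes differences of weights available, which are the
  expectations that Hoeffding's inequality is about.
\<close>

lemma weight_finite_support:
  assumes "finite F" "F \<subseteq> verts G" "\<forall>s\<in>verts G - F. m s = 0" "\<forall>s. 0 \<le> m s"
  shows "weight G m v = ennreal (\<Sum>s\<in>F. (graph_dist G v s)\<^sup>2 * m s)"
proof -
  have "weight G m v = (\<Sum>\<^sub>\<infinity>s\<in>F. ennreal ((graph_dist G v s)\<^sup>2 * m s))"
    unfolding weight_def by (rule infsum_cong_neutral) (use assms in auto)
  also have "\<dots> = ennreal (\<Sum>s\<in>F. (graph_dist G v s)\<^sup>2 * m s)"
    using assms by (simp add: sum_ennreal)
  finally show ?thesis .
qed

lemma weight_le_iff_finite_support:
  assumes "finite F" "F \<subseteq> verts G" "\<forall>s\<in>verts G - F. m s = 0" "\<forall>s. 0 \<le> m s"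
  shows "weight G m u \<le> weight G m v \<longleftrightarrow>
         (\<Sum>s\<in>F. (graph_dist G u s)\<^sup>2 * m s) \<le> (\<Sum>s\<in>F. (graph_dist G v s)\<^sup>2 * m s)"
  using assms by (simp add: weight_finite_support[OF assms] ennreal_le_iff sum_nonneg)

text \<open>
  A vertex that is farther than \<open>c\<close> from every point of the support cannot beat \<open>c\<close>. The bound does
  not mention the values of \<open>m\<close>, so one finite set confines the minimizers of all nonzero
  masses on \<open>F\<close>.
\<close>

lemma weight_le_imp_near_support:
  assumes "sym_digraph G" "Digraph_Component.connected G"
    and F: "finite F" "F \<subseteq> verts G"
    and m: "\<forall>s\<in>verts G - F. m s = 0" "\<forall>s. 0 \<le> m s" "\<exists>s\<in>F. 0 < m s"
    and c: "c \<in> verts G"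
    and v: "v \<in> verts G" "weight G m v \<le> weight G m c"
  shows "\<exists>s\<in>F. graph_dist G v s \<le> graph_dist G c s"
proof (rule ccontr)
  assume "\<not> ?thesis"
  then have far: "graph_dist G c s < graph_dist G v s" if "s \<in> F" for s using that by force
  have sq: "(graph_dist G c s)\<^sup>2 < (graph_dist G v s)\<^sup>2" if "s \<in> F" for s
  proof -
    have "0 \<le> graph_dist G c s" using graph_dist_nonneg[OF assms(1,2) c] F(2) that by auto
    with far[OF that] show ?thesis by (intro power_strict_mono) auto
  qed
  have "(\<Sum>s\<in>F. (graph_dist G c s)\<^sup>2 * m s) < (\<Sum>s\<in>F. (graph_dist G v s)\<^sup>2 * m s)"
  proof (rule sum_strict_mono_ex1[OF F(1)])
    show "\<forall>s\<in>F. (graph_dist G c s)\<^sup>2 * m s \<le> (graph_dist G v s)\<^sup>2 * m s"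
      using sq m(2) by (meson less_imp_le mult_right_mono)
    show "\<exists>s\<in>F. (graph_dist G c s)\<^sup>2 * m s < (graph_dist G v s)\<^sup>2 * m s"
      using sq m(3) by (blast intro: mult_strict_right_mono)
  qed
  with v(2) show False by (simp add: weight_le_iff_finite_support[OF F m(1,2)])
qed

text \<open>
  The vertex set may be infinite and the weights may be arbitrary reals, so it is the confinement to
  a finite set of candidates that makes the infimum a minimum.
\<close>

lemma weight_minimizers_nonempty:
  assumes "sym_digraph G" "Digraph_Component.connected G" "locally_finite_graph G"
    and F: "finite F" "F \<subseteq> verts G"
    and m: "\<forall>s\<in>verts G - F. m s = 0" "\<forall>s. 0 \<le> m s" "\<exists>s\<in>F. 0 < m s"
  shows "weight_minimizers G m \<noteq> {}"
proof -
  obtain c where c: "c \<in> F" using m(3) by blast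
  define B where "B = {v \<in> verts G. \<exists>s\<in>F. graph_dist G v s \<le> graph_dist G c s}"
  have "B = (\<Union>s\<in>F. {v \<in> verts G. graph_dist G v s \<le> graph_dist G c s})" by (auto simp: B_def)
  then have fin: "finite B" using finite_dist_ball[OF assms(1-3)] F by auto
  have cB: "c \<in> B" using c F by (auto simp: B_def)
  define w where "w = arg_min_on (weight G m) B"
  have w: "w \<in> B" and le: "weight G m w \<le> weight G m u" if "u \<in> B" for u
    using arg_min_if_finite[OF fin, of "weight G m"] cB that by (auto simp: w_def not_less)
  have "weight G m w \<le> weight G m u" if u: "u \<in> verts G" for u
  proof (cases "weight G m u \<le> weight G m c")
    case True
    then have "u \<in> B"
      using weight_le_imp_near_support[OF assms(1,2) F m _ u True] c F u by (auto simp: B_def)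
    then show ?thesis by (rule le)
  next
    case False
    then show ?thesis using le[OF cB] by auto
  qed
  then have "w \<in> weight_minimizers G m" using w[OF cB] by (auto simp: weight_minimizers_def B_def)
  then show ?thesis by blast
qed

lemma sum_empirical_mass:
  assumes "finite F" "\<And>i. i \<in> {1..n} \<Longrightarrow> x i \<in> F"
  shows "(\<Sum>s\<in>F. f s * empirical_mass n x s) = (\<Sum>i\<in>{1..n}. f (x i)) / real n"
proof -
  have "(\<Sum>i\<in>{1..n}. f (x i)) = (\<Sum>s\<in>F. \<Sum>i\<in>{i\<in>{1..n}. x i = s}. f (x i))"
    by (rule sum.group[symmetric]) (use assms in auto)
  also have "\<dots> = (\<Sum>s\<in>F. f s * real (card {i\<in>{1..n}. x i = s}))"
    by (intro sum.cong) auto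
  finally show ?thesis by (simp add: empirical_mass_def sum_divide_distrib)
qed

section \<open>Finitely supported random elements\<close>

lemma AE_in_support:
  assumes "prob_space P" "countable V" "X \<in> measurable P (count_space V)"
  shows "AE \<omega> in P. X \<omega> \<in> {v \<in> V. prob_mass P X v \<noteq> 0}"
proof -
  interpret prob_space P by fact
  have "AE \<omega> in P. \<forall>v\<in>{v\<in>V. prob_mass P X v = 0}. X \<omega> \<noteq> v"
  proof (subst AE_ball_countable)
    show "countable {v \<in> V. prob_mass P X v = 0}" using assms(2) by (rule countable_subset[rotated]) auto
    show "\<forall>v\<in>{v\<in>V. prob_mass P X v = 0}. AE \<omega> in P. X \<omega> \<noteq> v"
    proof
      fix v assume v: "v \<in> {v\<in>V. prob_mass P X v = 0}"
      have "X -` {v} \<inter> space P \<in> sets P" by (rule measurable_sets[OF assms(3)]) (use v in auto)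
      moreover have "X -` {v} \<inter> space P = {\<omega> \<in> space P. X \<omega> = v}" by auto
      ultimately show "AE \<omega> in P. X \<omega> \<noteq> v"
        using v by (intro AE_I[of _ _ "{\<omega> \<in> space P. X \<omega> = v}"]) (auto simp: prob_mass_def emeasure_eq_measure)
    qed
  qed
  moreover have "AE \<omega> in P. X \<omega> \<in> V" using measurable_space[OF assms(3)] by auto
  ultimately show ?thesis by eventually_elim auto
qed

lemma expectation_finite_support:
  fixes f :: "'a \<Rightarrow> real"
  assumes "prob_space P" "X \<in> measurable P (count_space V)"
    and F: "finite F" "F \<subseteq> V" "AE \<omega> in P. X \<omega> \<in> F"
  shows "(\<integral>\<omega>. f (X \<omega>) \<partial>P) = (\<Sum>s\<in>F. f s * prob_mass P X s)"
proof -
  interpret prob_space P by fact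
  have meas [measurable]: "{\<omega> \<in> space P. X \<omega> = s} \<in> sets P" if "s \<in> F" for s
  proof -
    have "X -` {s} \<inter> space P \<in> sets P" by (rule measurable_sets[OF assms(2)]) (use that F in auto)
    moreover have "X -` {s} \<inter> space P = {\<omega> \<in> space P. X \<omega> = s}" by auto
    ultimately show ?thesis by simp
  qed
  have [measurable]: "(\<lambda>\<omega>. f (X \<omega>)) \<in> borel_measurable P"
    by (rule measurable_compose[OF assms(2)]) simp
  have "(\<integral>\<omega>. f (X \<omega>) \<partial>P) = (\<integral>\<omega>. (\<Sum>s\<in>F. f s * indicator {\<omega> \<in> space P. X \<omega> = s} \<omega>) \<partial>P)"
  proof (rule integral_cong_AE)
    show "AE \<omega> in P. f (X \<omega>) = (\<Sum>s\<in>F. f s * indicator {\<omega> \<in> space P. X \<omega> = s} \<omega>)"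
      using F(3) AE_space
    proof eventually_elim
      case (elim \<omega>)
      have "(\<Sum>s\<in>F. f s * indicator {\<omega> \<in> space P. X \<omega> = s} \<omega>) = (\<Sum>s\<in>F. if X \<omega> = s then f s else 0)"
        using elim by (intro sum.cong) (auto simp: indicator_def)
      then show ?case using elim F(1) by simp
    qed
  qed (auto intro!: borel_measurable_sum)
  also have "\<dots> = (\<Sum>s\<in>F. f s * prob_mass P X s)"
    by (subst Bochner_Integration.integral_sum)
       (auto simp: prob_mass_def emeasure_eq_measure intro!: integrable_mult_right)
  finally show ?thesis .
qed

text \<open>
  A nonnegative sum means that the sample average exceeds the negative mean by at least the absolute
  value of that mean. This deviation does not depend on \<open>n\<close>, so Hoeffding's inequality gives
  exponential decay.
\<close>

lemma iid_sum_nonneg_exponentially_small: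
  fixes f :: "'a \<Rightarrow> real"
  assumes "prob_space P"
    and indep: "prob_space.indep_vars P (\<lambda>_. count_space V) \<xi> {1..}"
    and ident: "\<And>i. i \<ge> 1 \<Longrightarrow> distr P (count_space V) (\<xi> i) = distr P (count_space V) (\<xi> 1)"
    and meas: "\<And>i. i \<ge> 1 \<Longrightarrow> \<xi> i \<in> measurable P (count_space V)"
    and F: "finite F" "AE \<omega> in P. \<xi> 1 \<omega> \<in> F"
    and neg: "(\<integral>\<omega>. f (\<xi> 1 \<omega>) \<partial>P) < 0"
  shows "\<exists>C>0. \<forall>n\<ge>1. measure P {\<omega> \<in> space P. 0 \<le> (\<Sum>i\<in>{1..n}. f (\<xi> i \<omega>))} \<le> exp (- C * real n)"
proof -
  interpret prob_space P by fact
  \<comment> \<open>The summand 1 guarantees that the interval \<open>{-M..M}\<close> is nondegenerate.\<close>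
  define M where "M = 1 + (\<Sum>s\<in>F. \<bar>f s\<bar>)"
  define e where "e = - expectation (\<lambda>\<omega>. f (\<xi> 1 \<omega>))"
  have M: "M > 0" unfolding M_def by (intro add_pos_nonneg sum_nonneg) auto
  have bound: "\<bar>f s\<bar> \<le> M" if "s \<in> F" for s
    using member_le_sum[of s F "\<lambda>s. \<bar>f s\<bar>"] F(1) that by (simp add: M_def)
  have e: "e > 0" using neg by (simp add: e_def)
  have f [measurable]: "f \<in> measurable (count_space V) borel" by simp
  show ?thesis
  proof (intro exI conjI allI impI)
    show "0 < 2 * e\<^sup>2 / (2 * M)\<^sup>2" using e M by simp
    fix n :: nat assume n: "n \<ge> 1"
    interpret Hoeffding_ineq_iid P "{1..n}" "\<lambda>i \<omega>. f (\<xi> i \<omega>)" "\<lambda>\<omega>. f (\<xi> 1 \<omega>)" "-M" M "-e"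
    proof unfold_locales
      show "indep_vars (\<lambda>_. borel) (\<lambda>i \<omega>. f (\<xi> i \<omega>)) {1..n}"
        by (rule indep_vars_compose2[OF indep_vars_subset[OF indep]]) auto
      show "distr P borel (\<lambda>\<omega>. f (\<xi> i \<omega>)) = distr P borel (\<lambda>\<omega>. f (\<xi> 1 \<omega>))" if "i \<in> {1..n}" for i
      proof -
        have *: "distr P borel (\<lambda>\<omega>. f (\<xi> j \<omega>)) = distr (distr P (count_space V) (\<xi> j)) borel f"
          if "j \<ge> 1" for j using distr_distr[OF f meas[OF that]] by (simp add: o_def)
        show ?thesis using *[of i] *[OF order_refl] ident[of i] that by simp
      qed
      show "(\<lambda>\<omega>. f (\<xi> 1 \<omega>)) \<in> borel_measurable P"
        by (rule measurable_compose[OF meas f]) simp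
      show "AE \<omega> in P. f (\<xi> 1 \<omega>) \<in> {-M..M}"
        using F(2) by eventually_elim (use bound in \<open>auto simp: abs_le_iff minus_le_iff\<close>)
    qed (simp_all add: e_def)
    show "prob {\<omega> \<in> space P. 0 \<le> (\<Sum>i\<in>{1..n}. f (\<xi> i \<omega>))} \<le> exp (- (2 * e\<^sup>2 / (2 * M)\<^sup>2) * real n)"
      using Hoeffding_ineq_ge'[of e] e M n by (simp add: zero_le_divide_iff mult_ac)
  qed
qed

text \<open>
  The exponential bounds come with different rates; a finite union is governed by the smallest.
\<close>

lemma finite_union_exponentially_small:
  assumes "finite I" "\<And>i n. i \<in> I \<Longrightarrow> A i n \<in> sets P"
    and "\<And>i. i \<in> I \<Longrightarrow> \<exists>C>0. \<forall>n\<ge>1. measure P (A i n) \<le> exp (- C * real n)"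
  shows "\<exists>C>0. \<exists>K>0. \<forall>n\<ge>1. measure P (\<Union>i\<in>I. A i n) \<le> K * exp (- C * real n)"
proof -
  have "\<forall>i\<in>I. \<exists>C>0. \<forall>n\<ge>1. measure P (A i n) \<le> exp (- C * real n)" using assms(3) by blast
  then obtain C where "\<forall>i\<in>I. C i > 0 \<and> (\<forall>n\<ge>1. measure P (A i n) \<le> exp (- C i * real n))"
    unfolding bchoice_iff by blast
  then have C: "C i > 0" "\<And>n. n \<ge> 1 \<Longrightarrow> measure P (A i n) \<le> exp (- C i * real n)" if "i \<in> I" for i
    using that by auto
  \<comment> \<open>The extra element 1 and the extra summand 1 cover the case that \<open>I\<close> is empty.\<close>
  define D where "D = Min (insert 1 (C ` I))"
  have D: "D \<le> C i" if "i \<in> I" for i using assms(1) that by (auto simp: D_def)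
  have D0: "D > 0" using C(1) assms(1) by (auto simp: D_def)
  show ?thesis
  proof (intro exI conjI allI impI)
    show "D > 0" by (rule D0)
    show "1 + real (card I) > 0" by simp
    fix n :: nat assume n: "n \<ge> 1"
    have "measure P (\<Union>i\<in>I. A i n) \<le> (\<Sum>i\<in>I. measure P (A i n))"
      using assms(1,2) by (intro measure_UNION_le) auto
    also have "\<dots> \<le> (\<Sum>i\<in>I. exp (- D * real n))"
    proof (rule sum_mono)
      fix i assume i: "i \<in> I"
      have "exp (- C i * real n) \<le> exp (- D * real n)" using D[OF i] by (simp add: mult_right_mono)
      with C(2)[OF i n] show "measure P (A i n) \<le> exp (- D * real n)" by (rule order_trans)
    qed
    also have "\<dots> \<le> (1 + real (card I)) * exp (- D * real n)" by (simp add: mult_right_mono)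
    finally show "measure P (\<Union>i\<in>I. A i n) \<le> (1 + real (card I)) * exp (- D * real n)" .
  qed
qed

section \<open>Exponential concentration of the sample mean-set\<close>

theorem theoremD:
  fixes G :: "('a, 'b) pre_digraph"
    and P :: "'w measure"
    and \<xi> :: "nat \<Rightarrow> 'w \<Rightarrow> 'a"
  assumes "sym_digraph G"
    and "Digraph_Component.connected G"
    and "locally_finite_graph G"
    and "prob_space P"
    and "\<And>i. i \<ge> 1 \<Longrightarrow> \<xi> i \<in> measurable P (count_space (verts G))"
    and "prob_space.indep_vars P (\<lambda>_. count_space (verts G)) \<xi> {1..}"
    and "\<And>i. i \<ge> 1 \<Longrightarrow>
           distr P (count_space (verts G)) (\<xi> i) = distr P (count_space (verts G)) (\<xi> 1)"
    and "weight_totally_defined G (prob_mass P (\<xi> 1))"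
    and "finite {v \<in> verts G. prob_mass P (\<xi> 1) v \<noteq> 0}"
  shows "\<exists>C>0. \<exists>K>0. \<forall>n\<ge>1.
           measure P {\<omega> \<in> space P.
             \<not> sample_mean_set G n (\<lambda>i. \<xi> i \<omega>) \<subseteq> mean_set G P (\<xi> 1)}
           \<le> K * exp (- C * real n)"
proof -
  interpret prob_space P by fact
  define m where "m = prob_mass P (\<xi> 1)"
  define F where "F = {v \<in> verts G. m v \<noteq> 0}"
  define d where "d = graph_dist G"
  have F: "finite F" "F \<subseteq> verts G" using assms(9) by (auto simp: F_def m_def)
  have supp1: "AE \<omega> in P. \<xi> 1 \<omega> \<in> F"
    using AE_in_support[OF assms(4) countable_verts[OF assms(1-3)] assms(5)[of 1]]
    by (simp add: F_def m_def)
  have supp: "AE \<omega> in P. \<xi> i \<omega> \<in> F" if i: "i \<ge> 1" for i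
  proof -
    have *: "(AE \<omega> in P. \<xi> j \<omega> \<in> F) \<longleftrightarrow> (AE x in distr P (count_space (verts G)) (\<xi> j). x \<in> F)"
      if "j \<ge> 1" for j by (rule AE_distr_iff[OF assms(5)[OF that], symmetric]) (use F in auto)
    show ?thesis using supp1 *[OF order_refl] *[OF i] unfolding assms(7)[OF i] by blast
  qed
  have m: "\<forall>s\<in>verts G - F. m s = 0" "\<forall>s. 0 \<le> m s" by (auto simp: F_def m_def prob_mass_def)
  have "F \<noteq> {}" using supp1 by auto
  then obtain c where c: "c \<in> F" by blast
  then have m_pos: "\<exists>s\<in>F. 0 < m s" using m(2) by (auto simp: F_def less_le)
  define E where "E = weight_minimizers G m"
  obtain w where w: "w \<in> E"
    using weight_minimizers_nonempty[OF assms(1-3) F m m_pos] by (auto simp: E_def)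
  then have wV: "w \<in> verts G" by (simp add: E_def weight_minimizers_def)
  define B where "B = {v \<in> verts G. \<exists>s\<in>F. d v s \<le> d w s}"
  have "B = (\<Union>s\<in>F. {v \<in> verts G. d v s \<le> d w s})" by (auto simp: B_def)
  then have finB: "finite B" using finite_dist_ball[OF assms(1-3)] F by (auto simp: d_def)
  define f where "f v s = (d w s)\<^sup>2 - (d v s)\<^sup>2" for v s
  define A where "A v n = {\<omega> \<in> space P. 0 \<le> (\<Sum>i\<in>{1..n}. f v (\<xi> i \<omega>))}" for v and n :: nat
  have meas_f: "(\<lambda>\<omega>. f v (\<xi> i \<omega>)) \<in> borel_measurable P" if "i \<ge> 1" for v i
    by (rule measurable_compose[OF assms(5)[OF that]]) simp
  have A_sets: "A v n \<in> sets P" for v n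
  proof -
    have [measurable]: "(\<lambda>\<omega>. \<Sum>i\<in>{1..n}. f v (\<xi> i \<omega>)) \<in> borel_measurable P"
      by (rule borel_measurable_sum) (use meas_f in auto)
    show ?thesis unfolding A_def by measurable
  qed
  have "\<exists>C>0. \<forall>n\<ge>1. measure P (A v n) \<le> exp (- C * real n)" if v: "v \<in> B - E" for v
  proof -
    obtain u where "u \<in> verts G" "\<not> weight G m v \<le> weight G m u"
      using v by (auto simp: B_def E_def weight_minimizers_def)
    moreover have "weight G m w \<le> weight G m u"
      using w \<open>u \<in> verts G\<close> by (auto simp: E_def weight_minimizers_def)
    ultimately have "\<not> weight G m v \<le> weight G m w" by auto
    then have "(\<Sum>s\<in>F. (d w s)\<^sup>2 * m s) < (\<Sum>s\<in>F. (d v s)\<^sup>2 * m s)"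
      by (simp add: weight_le_iff_finite_support[OF F m] d_def)
    then have "(\<integral>\<omega>. f v (\<xi> 1 \<omega>) \<partial>P) < 0"
      by (subst expectation_finite_support[OF assms(4) assms(5) F supp1])
         (auto simp: f_def m_def left_diff_distrib sum_subtractf)
    from iid_sum_nonneg_exponentially_small[OF assms(4,6,7,5) F(1) supp1 this]
    show ?thesis by (simp add: A_def)
  qed
  then obtain C K where CK: "C > 0" "K > 0"
    "\<And>n. n \<ge> 1 \<Longrightarrow> measure P (\<Union>v\<in>B - E. A v n) \<le> K * exp (- C * real n)"
    using finite_union_exponentially_small[of "B - E" A P] finB A_sets by blast
  have "measure P {\<omega> \<in> space P. \<not> sample_mean_set G n (\<lambda>i. \<xi> i \<omega>) \<subseteq> mean_set G P (\<xi> 1)}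
      \<le> measure P (\<Union>v\<in>B - E. A v n)" if n: "n \<ge> 1" for n
  proof (rule finite_measure_mono_AE)
    show "(\<Union>v\<in>B - E. A v n) \<in> sets P" using finB A_sets by auto
    have "AE \<omega> in P. \<forall>i\<in>{1..n}. \<xi> i \<omega> \<in> F"
      by (rule AE_finite_allI) (use supp in auto)
    then show "AE \<omega> in P. \<omega> \<in> {\<omega> \<in> space P. \<not> sample_mean_set G n (\<lambda>i. \<xi> i \<omega>) \<subseteq> mean_set G P (\<xi> 1)}
        \<longrightarrow> \<omega> \<in> (\<Union>v\<in>B - E. A v n)"
    proof eventually_elim
      case (elim \<omega>)
      define x where "x = (\<lambda>i. \<xi> i \<omega>)"
      define \<mu> where "\<mu> = empirical_mass n x"
      have x: "x i \<in> F" if "i \<in> {1..n}" for i using elim that by (simp add: x_def)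
      have none: "{i \<in> {1..n}. x i = s} = {}" if "s \<notin> F" for s using x that by blast
      have \<mu>: "\<forall>s\<in>verts G - F. \<mu> s = 0" "\<forall>s. 0 \<le> \<mu> s"
        using none by (auto simp: \<mu>_def empirical_mass_def)
      have "1 \<in> {i \<in> {1..n}. x i = x 1}" using n by simp
      then have "card {i \<in> {1..n}. x i = x 1} > 0" by (subst card_gt_0_iff) auto
      then have "\<mu> (x 1) > 0" using n by (simp add: \<mu>_def empirical_mass_def)
      then have \<mu>_pos: "\<exists>s\<in>F. 0 < \<mu> s" using x[of 1] n by auto
      show ?case
      proof
        assume \<omega>: "\<omega> \<in> {\<omega> \<in> space P. \<not> sample_mean_set G n (\<lambda>i. \<xi> i \<omega>) \<subseteq> mean_set G P (\<xi> 1)}"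
        then obtain v where v: "v \<in> weight_minimizers G \<mu>" "v \<notin> E"
          by (auto simp: sample_mean_set_def mean_set_def \<mu>_def x_def E_def m_def)
        then have vV: "v \<in> verts G" and le: "weight G \<mu> v \<le> weight G \<mu> w"
          using wV by (auto simp: weight_minimizers_def)
        have "v \<in> B"
          using weight_le_imp_near_support[OF assms(1,2) F \<mu> \<mu>_pos wV vV le] vV
          by (simp add: B_def d_def)
        have "0 \<le> (\<Sum>s\<in>F. f v s * \<mu> s)"
          using le by (simp add: weight_le_iff_finite_support[OF F \<mu>] f_def d_def
              left_diff_distrib sum_subtractf)
        also have "\<dots> = (\<Sum>i\<in>{1..n}. f v (x i)) / real n"
          unfolding \<mu>_def by (rule sum_empirical_mass[OF F(1) x])
        finally have "\<omega> \<in> A v n" using n \<omega> by (simp add: A_def x_def zero_le_divide_iff)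
        then show "\<omega> \<in> (\<Union>v\<in>B - E. A v n)" using \<open>v \<in> B\<close> v(2) by blast
      qed
    qed
  qed
  then show ?thesis using CK by (meson order_trans)
qed

end
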